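(* For every $n\ge 1$ there exists a constant $C_n$, depending on the dimension $n$ but not on the operator $A$ (nor on $X$), such that the following holds. For any operator $A$ from $\mathcal{S}(\mathbb{R}^n)$ to $\mathcal{S}'(\mathbb{R}^n)$ whose iterated commutators $(\mathrm{ad}\,a(V))^\alpha A$ are bounded in $L^2(\mathbb{R}^n)$ for all multi-indices $\alpha$ with $|\alpha|\le 2n+1$, and for all $X\in\mathbb{R}^{2n}$, $$\int_{\mathbb{R}^{2n}}|\langle A\Psi_{X+Z},\Psi_{X-Z}\rangle|\,dZ\le C_n\sum_{|\alpha|\le 2n+1}\|(\mathrm{ad}\,a(V))^\alpha A\| .$$
   Context: Operators from $\mathcal{S}(\mathbb{R}^n)$ to $\mathcal{S}'(\mathbb{R}^n)$ are linear and continuous. $\langle f,g\rangle=\int_{\mathbb{R}^n} f(u)\overline{g(u)}\,du$ is the $L^2(\mathbb{R}^n)$ inner product and $\|\cdot\|$ is the operator norm on $L^2(\mathbb{R}^n)$. For $X=(x,\xi)\in\mathbb{R}^{2n}$ (with $x,\xi\in\mathbb{R}^n$), the coherent state $\Psi_X$ is $$\Psi_{x,\xi}(u)=\pi^{-n/4}e^{-\frac12|u-x|^2+iu\cdot\xi-\frac i2 x\cdot\xi}.$$ $V_1,\dots,V_n$ is the canonical basis of $\mathbb{R}^n$, and $a(V_j)=x_j+\partial_{x_j}$, acting on functions (and tempered distributions) of $x\in\mathbb{R}^n$. For an operator $B$, $\mathrm{ad}\,B$ is the map $A\mapsto[B,A]=BA-AB$. For a multi-index $\alpha\in\mathbb{N}^n$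 and an operator $A$ from $\mathcal{S}(\mathbb{R}^n)$ to $\mathcal{S}'(\mathbb{R}^n)$, $$(\mathrm{ad}\,a(V))^\alpha A=(\mathrm{ad}\,a(V_1))^{\alpha_1}\cdots(\mathrm{ad}\,a(V_n))^{\alpha_n}A,$$ which includes $A$ itself for $\alpha=0$. An operator from $\mathcal{S}(\mathbb{R}^n)$ to $\mathcal{S}'(\mathbb{R}^n)$ is bounded in $L^2(\mathbb{R}^n)$ if it extends to a bounded operator on $L^2(\mathbb{R}^n)$. *)

theory Defs
  imports "HOL-Analysis.Analysis"
begin

text \<open>
  The ambient space is \<^typ>\<open>real ^ 'n\<close> with \<open>n = CARD('n)\<close>.  The index type carries a linear
  order, so that ordered products over \<open>j = 1, \<dots>, n\<close> make sense.
\<close>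

type_synonym 'n cfun = "real ^ 'n \<Rightarrow> complex"
type_synonym 'n functional = "'n cfun \<Rightarrow> complex"
type_synonym 'n operator = "'n cfun \<Rightarrow> 'n functional"


subsection \<open>Schwartz functions\<close>

definition partial :: "'n::finite \<Rightarrow> 'n cfun \<Rightarrow> 'n cfun" where
  "partial j f = (\<lambda>x. vector_derivative (\<lambda>t. f (x + t *\<^sub>R axis j 1)) (at 0))"

definition partials :: "'n::finite list \<Rightarrow> 'n cfun \<Rightarrow> 'n cfun" where
  "partials js f = foldr partial js f"

definition smooth :: "'n::finite cfun \<Rightarrow> bool" where
  "smooth f \<longleftrightarrow> (\<forall>js x. partials js f differentiable (at x))"

definition schwartz :: "'n::finite cfun set" where
  "schwartz = {f. smooth f \<and>
     (\<forall>k js. bdd_above (range (\<lambda>x. (1 + norm x) ^ k * cmod (partials js f x))))}"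

definition schwartz_seminorm :: "nat \<Rightarrow> 'n::finite list \<Rightarrow> 'n cfun \<Rightarrow> real" where
  "schwartz_seminorm k js f = (SUP x. (1 + norm x) ^ k * cmod (partials js f x))"

definition schwartz_topology :: "'n::finite cfun topology" where
  "schwartz_topology = topology_generated_by
     {{g \<in> schwartz. schwartz_seminorm k js (\<lambda>x. g x - f x) < r} | k js f r. f \<in> schwartz \<and> r > 0}"


subsection \<open>Tempered distributions and operators from \<open>S\<close> to \<open>S'\<close>\<close>

text \<open>
  A tempered distribution is represented by a function on all of \<^typ>\<open>'n cfun\<close>; its values
  outside \<open>schwartz\<close> are junk and are never used.  The same holds for an operator, which is
  only applied to elements of \<open>schwartz\<close>.
\<close>

definition linear_on_schwartz :: "'n::finite functional \<Rightarrow> bool" where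
  "linear_on_schwartz T \<longleftrightarrow>
     (\<forall>f\<in>schwartz. \<forall>g\<in>schwartz. T (\<lambda>x. f x + g x) = T f + T g) \<and>
     (\<forall>c. \<forall>f\<in>schwartz. T (\<lambda>x. c * f x) = c * T f)"

definition tempered :: "'n::finite functional set" where
  "tempered = {T. linear_on_schwartz T \<and> continuous_map schwartz_topology euclidean T}"

text \<open>The weak-* topology.\<close>

definition tempered_topology :: "'n::finite functional topology" where
  "tempered_topology = topology_generated_by
     {{T \<in> tempered. T \<phi> \<in> U} | \<phi> U. \<phi> \<in> schwartz \<and> open U}"

definition schwartz_operator :: "'n::finite operator \<Rightarrow> bool" where
  "schwartz_operator A \<longleftrightarrow>
     (\<forall>\<phi>\<in>schwartz. linear_on_schwartz (\<lambda>f. A f \<phi>)) \<and>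
     continuous_map schwartz_topology tempered_topology A"


subsection \<open>The operators \<open>a(V\<^sub>j) = x\<^sub>j + \<partial>\<^sub>j\<close> and iterated commutators\<close>

definition mult_coord :: "'n::finite \<Rightarrow> 'n cfun \<Rightarrow> 'n cfun" where
  "mult_coord j f = (\<lambda>x. complex_of_real (x $ j) * f x)"

definition a_fun :: "'n::finite \<Rightarrow> 'n cfun \<Rightarrow> 'n cfun" where
  "a_fun j f = (\<lambda>x. mult_coord j f x + partial j f x)"

definition dist_mult_coord :: "'n::finite \<Rightarrow> 'n functional \<Rightarrow> 'n functional" where
  "dist_mult_coord j T = (\<lambda>\<phi>. T (mult_coord j \<phi>))"

definition dist_partial :: "'n::finite \<Rightarrow> 'n functional \<Rightarrow> 'n functional" where
  "dist_partial j T = (\<lambda>\<phi>. - T (partial j \<phi>))"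

definition a_dist :: "'n::finite \<Rightarrow> 'n functional \<Rightarrow> 'n functional" where
  "a_dist j T = (\<lambda>\<phi>. dist_mult_coord j T \<phi> + dist_partial j T \<phi>)"

definition ad_a :: "'n::finite \<Rightarrow> 'n operator \<Rightarrow> 'n operator" where
  "ad_a j A = (\<lambda>f \<phi>. a_dist j (A f) \<phi> - A (a_fun j f) \<phi>)"

text \<open>
  The powers of the \<^term>\<open>ad_a j\<close> are composed in increasing order of \<open>j\<close>, the smallest index
  outermost.
\<close>

definition ad_a_multi :: "('n::{finite,linorder} \<Rightarrow> nat) \<Rightarrow> 'n operator \<Rightarrow> 'n operator" where
  "ad_a_multi \<alpha> A = foldr (\<lambda>j. ad_a j ^^ \<alpha> j) (sorted_list_of_set UNIV) A"


subsection \<open>Boundedness in \<open>L\<^sup>2\<close>\<close>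

text \<open>
  Elements of \<open>L\<^sup>2\<close> are represented by Borel functions, identified almost everywhere.
\<close>

definition L2 :: "'n::finite cfun set" where
  "L2 = {f \<in> borel_measurable lborel. integrable lborel (\<lambda>u. (cmod (f u))\<^sup>2)}"

definition L2_inner :: "'n::finite cfun \<Rightarrow> 'n cfun \<Rightarrow> complex" where
  "L2_inner f g = (LINT u|lborel. f u * cnj (g u))"

definition L2_norm :: "'n::finite cfun \<Rightarrow> real" where
  "L2_norm f = sqrt (LINT u|lborel. (cmod (f u))\<^sup>2)"

text \<open>
  Linearity up to null sets together with the bound makes such a \<open>B\<close> well defined on
  almost-everywhere classes.
\<close>

definition bounded_L2_operator :: "('n::finite cfun \<Rightarrow> 'n cfun) \<Rightarrow> bool" where
  "bounded_L2_operator B \<longleftrightarrow>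
     (\<forall>f\<in>L2. B f \<in> L2) \<and>
     (\<forall>f\<in>L2. \<forall>g\<in>L2. AE u in lborel. B (\<lambda>x. f x + g x) u = B f u + B g u) \<and>
     (\<forall>c. \<forall>f\<in>L2. AE u in lborel. B (\<lambda>x. c * f x) u = c * B f u) \<and>
     (\<exists>K. \<forall>f\<in>L2. L2_norm (B f) \<le> K * L2_norm f)"

definition L2_opnorm :: "('n::finite cfun \<Rightarrow> 'n cfun) \<Rightarrow> real" where
  "L2_opnorm B = (SUP f\<in>{f \<in> L2. L2_norm f \<le> 1}. L2_norm (B f))"

text \<open>The embedding of \<open>L\<^sup>2\<close> into the tempered distributions.\<close>

definition dist_of :: "'n::finite cfun \<Rightarrow> 'n functional" where
  "dist_of h = (\<lambda>\<phi>. LINT u|lborel. h u * \<phi> u)"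

definition is_L2_extension :: "'n::finite operator \<Rightarrow> ('n cfun \<Rightarrow> 'n cfun) \<Rightarrow> bool" where
  "is_L2_extension A B \<longleftrightarrow> bounded_L2_operator B \<and>
     (\<forall>f\<in>schwartz. \<forall>\<phi>\<in>schwartz. A f \<phi> = dist_of (B f) \<phi>)"

definition L2_bounded :: "'n::finite operator \<Rightarrow> bool" where
  "L2_bounded A \<longleftrightarrow> (\<exists>B. is_L2_extension A B)"

text \<open>The extension is unique up to null sets, because Schwartz functions are dense in \<open>L\<^sup>2\<close>.\<close>

definition L2_extension :: "'n::finite operator \<Rightarrow> 'n cfun \<Rightarrow> 'n cfun" where
  "L2_extension A = (SOME B. is_L2_extension A B)"

definition operator_norm :: "'n::finite operator \<Rightarrow> real" where
  "operator_norm A = L2_opnorm (L2_extension A)"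


subsection \<open>Coherent states\<close>

definition coherent :: "(real ^ 'n::finite) \<times> (real ^ 'n) \<Rightarrow> 'n cfun" where
  "coherent X = (case X of (x, \<xi>) \<Rightarrow> \<lambda>u.
     complex_of_real (pi powr (- real CARD('n) / 4)) *
     exp (complex_of_real (- (norm (u - x))\<^sup>2 / 2)
          + \<i> * complex_of_real (u \<bullet> \<xi>) - \<i> / 2 * complex_of_real (x \<bullet> \<xi>)))"

end

theory Submission
  imports Defs "HOL-Computational_Algebra.Polynomial"
begin

text \<open>
  Write \<open>z\<^sub>j(X) = x\<^sub>j + i \<xi>\<^sub>j\<close>.  A coherent state is a joint eigenfunction,
  \<open>a(V\<^sub>j) \<Psi>\<^sub>X = z\<^sub>j(X) \<Psi>\<^sub>X\<close>, and applying the transpose \<open>u\<^sub>j - \<partial>\<^sub>j\<close> repeatedly to the conjugate of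
  \<open>\<Psi>\<^sub>Y\<close>, corrected by \<open>z\<^sub>j(Y)\<close>, produces Hermite polynomials in \<open>u\<^sub>j - y\<^sub>j\<close> times that Gaussian,
  whose norms do not depend on \<open>Y\<close>.  Pairing \<open>[a(V\<^sub>j), A]\<close> with these functions for the points
  \<open>X + Z\<close> and \<open>X - Z\<close> yields the scalar factor \<open>z\<^sub>j(X - Z) - z\<^sub>j(X + Z) = - 2 z\<^sub>j(Z)\<close>.  Each commutator
  thus gains one power of \<open>\<bar>z\<^sub>j(Z)\<bar>\<close>, and \<open>2 n + 1\<close> of them give a bound \<open>C (1 + \<bar>Z\<bar>)\<^bsup>-(2n+1)\<^esup>\<close>, which
  is integrable over the \<open>2 n\<close>-dimensional phase space.
\<close>

section \<open>Integrable decay of order one more than the dimension\<close>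

subsection \<open>Integrability of power decay\<close>

text \<open>On the half-line the antiderivative \<open>(1 + x) powr (1 - s) / (1 - s)\<close> tends
  to 0 since \<open>1 - s < 0\<close>; the other half follows by reflection.\<close>

lemma nn_integral_power_decay_real:
  fixes s :: real
  assumes "s > 1"
  shows "(\<integral>\<^sup>+x. ennreal ((1 + \<bar>x\<bar>) powr (-s)) \<partial>lborel) < \<infinity>"
proof -
  let ?f = "\<lambda>x::real. (1 + \<bar>x\<bar>) powr (-s)"
  let ?I = "\<integral>\<^sup>+x. ennreal (?f x) * indicator {0..} x \<partial>lborel"
  have deriv: "DERIV (\<lambda>x. (1 + x) powr (1 - s) / (1 - s)) x :> ?f x" if "0 \<le> x" for x
    using that assms by (auto intro!: derivative_eq_intros)
  have "((\<lambda>x::real. (1 + x) powr (1 - s) / (1 - s)) \<longlongrightarrow> 0 / (1 - s)) at_top"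
    using assms
    by (intro tendsto_divide tendsto_const tendsto_neg_powr filterlim_tendsto_add_at_top
        filterlim_ident) auto
  then have half: "?I = ennreal (0 / (1 - s) - (1 + 0) powr (1 - s) / (1 - s))"
    by (intro nn_integral_FTC_atLeast deriv) auto
  have "(\<integral>\<^sup>+x. ennreal (?f x) * indicator {..0} x \<partial>lborel) = ?I"
    by (subst nn_integral_real_affine[where c="-1" and t=0]) (auto intro!: nn_integral_cong simp: indicator_def)
  then have refl: "(\<integral>\<^sup>+x. ennreal (?f x) * indicator {..0} x \<partial>lborel) < \<infinity>"
    using half by simp
  have "(\<integral>\<^sup>+x. ennreal (?f x) \<partial>lborel)
      \<le> (\<integral>\<^sup>+x. ennreal (?f x) * indicator {0..} x + ennreal (?f x) * indicator {..0} x \<partial>lborel)"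
    by (intro nn_integral_mono) (auto simp: indicator_def)
  also have "\<dots> = ?I + (\<integral>\<^sup>+x. ennreal (?f x) * indicator {..0} x \<partial>lborel)"
    by (intro nn_integral_add) auto
  also have "\<dots> < \<infinity>"
    using half refl by simp
  finally show ?thesis .
qed

text \<open>Each coordinate is at most \<open>norm x\<close> in modulus, so the function is
  dominated by a product of one-dimensional factors. Splitting the exponent d + 1 evenly over d
  coordinates leaves s = 1 + 1/d > 1 for each, and the integral of the product factorises.\<close>

lemma integrable_power_decay:
  "integrable lborel (\<lambda>x::'a::euclidean_space. 1 / (1 + norm x) ^ (DIM('a) + 1))"
proof (rule integrableI_bounded)
  define s where "s = 1 + 1 / real DIM('a)"
  have s: "s > 1"
    by (simp add: s_def)
  have ds: "real DIM('a) * s = real (DIM('a) + 1)"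
    by (simp add: s_def field_simps)
  let ?f = "\<lambda>x::real. (1 + \<bar>x\<bar>) powr (-s)"
  have "norm (1 / (1 + norm x) ^ (DIM('a) + 1)) \<le> (\<Prod>b\<in>Basis. ?f (x \<bullet> b))" for x :: 'a
  proof -
    have "1 / (1 + norm x) ^ (DIM('a) + 1) = (1 + norm x) powr (- (real DIM('a) * s))"
      unfolding ds by (subst powr_minus, subst powr_realpow) (auto simp: field_simps add_pos_nonneg)
    also have "\<dots> = (\<Prod>b\<in>(Basis::'a set). (1 + norm x) powr (-s))"
      by (simp add: powr_power add_nonneg_eq_0_iff mult.commute)
    also have "\<dots> \<le> (\<Prod>b\<in>Basis. ?f (x \<bullet> b))"
      using s by (intro prod_mono conjI powr_mono2') (auto simp: Basis_le_norm)
    finally show ?thesis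
      by simp
  qed
  then have "(\<integral>\<^sup>+x. ennreal (norm (1 / (1 + norm x) ^ (DIM('a) + 1))) \<partial>(lborel :: 'a measure))
      \<le> (\<integral>\<^sup>+x. (\<Prod>b\<in>Basis. ennreal (?f (x \<bullet> b))) \<partial>(lborel :: 'a measure))"
    by (intro nn_integral_mono) (simp add: prod_ennreal ennreal_leI)
  also have "\<dots> = (\<Prod>b\<in>(Basis::'a set). \<integral>\<^sup>+x. ennreal (?f x) \<partial>lborel)"
    by (rule nn_integral_lborel_prod) auto
  also have "\<dots> < \<infinity>"
    using nn_integral_power_decay_real[OF s] by (simp add: power_less_top_ennreal)
  finally show "(\<integral>\<^sup>+x. ennreal (norm (1 / (1 + norm x) ^ (DIM('a) + 1))) \<partial>(lborel :: 'a measure)) < \<infinity>" .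
qed simp

section \<open>Vector space structure of \<open>L2\<close> and the Cauchy-Schwarz inequality\<close>

subsection \<open>Square integrable functions\<close>

lemma L2_add:
  assumes "f \<in> L2" "g \<in> L2"
  shows "(\<lambda>x. f x + g x) \<in> L2"
proof -
  have [measurable]: "f \<in> borel_measurable lborel" "g \<in> borel_measurable lborel"
    using assms by (auto simp: L2_def)
  have bound: "(cmod (f x + g x))\<^sup>2 \<le> 2 * (cmod (f x))\<^sup>2 + 2 * (cmod (g x))\<^sup>2" for x
  proof -
    have "(cmod (f x + g x))\<^sup>2 \<le> (cmod (f x) + cmod (g x))\<^sup>2"
      by (intro power_mono norm_triangle_ineq) auto
    also have "\<dots> \<le> 2 * (cmod (f x))\<^sup>2 + 2 * (cmod (g x))\<^sup>2"
      using sum_squares_bound[of "cmod (f x)" "cmod (g x)"] by (simp add: power2_sum)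
    finally show ?thesis .
  qed
  have "integrable lborel (\<lambda>x. (cmod (f x + g x))\<^sup>2)"
    by (rule Bochner_Integration.integrable_bound
        [of _ "\<lambda>x. 2 * (cmod (f x))\<^sup>2 + 2 * (cmod (g x))\<^sup>2"])
      (use assms bound in \<open>auto simp: L2_def\<close>)
  then show ?thesis
    by (simp add: L2_def)
qed

lemma L2_scale: "f \<in> L2 \<Longrightarrow> (\<lambda>x. c * f x) \<in> L2"
  by (auto simp: L2_def norm_mult power_mult_distrib)

lemma L2_diff: "f \<in> L2 \<Longrightarrow> g \<in> L2 \<Longrightarrow> (\<lambda>x. f x - g x) \<in> L2"
  using L2_add[of f "\<lambda>x. (-1) * g x"] L2_scale[of g "-1"] by simp

lemma L2_cnj: "f \<in> L2 \<Longrightarrow> (\<lambda>x. cnj (f x)) \<in> L2"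
  using borel_measurable_continuous_on[of cnj f lborel]
  by (auto simp: L2_def intro: continuous_intros)

lemma L2_norm_nonneg: "0 \<le> L2_norm f"
  by (simp add: L2_norm_def)

lemma L2_norm_cnj: "L2_norm (\<lambda>x. cnj (f x)) = L2_norm f"
  by (simp add: L2_norm_def)

lemma L2_norm_scale: "L2_norm (\<lambda>x. c * f x) = cmod c * L2_norm f"
  by (simp add: L2_norm_def norm_mult power_mult_distrib real_sqrt_mult)

lemma L2_norm_cong_AE:
  assumes "f \<in> L2" "g \<in> L2" "AE x in lborel. f x = g x"
  shows "L2_norm f = L2_norm g"
proof -
  have [measurable]: "f \<in> borel_measurable lborel" "g \<in> borel_measurable lborel"
    using assms by (auto simp: L2_def)
  show ?thesis
    unfolding L2_norm_def using assms(3) by (intro arg_cong[where f=sqrt] integral_cong_AE) auto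
qed

lemma L2_mult_integrable:
  assumes "f \<in> L2" "g \<in> L2"
  shows "integrable lborel (\<lambda>x. f x * g x)"
proof -
  have [measurable]: "f \<in> borel_measurable lborel" "g \<in> borel_measurable lborel"
    using assms by (auto simp: L2_def)
  have "cmod (f x * g x) \<le> (cmod (f x))\<^sup>2 + (cmod (g x))\<^sup>2" for x
    using sum_squares_bound[of "cmod (f x)" "cmod (g x)"]
      mult_nonneg_nonneg[OF norm_ge_zero[of "f x"] norm_ge_zero[of "g x"]]
    unfolding norm_mult by linarith
  then have "AE x in lborel. norm (f x * g x) \<le> norm ((cmod (f x))\<^sup>2 + (cmod (g x))\<^sup>2)"
    by simp
  moreover have "integrable lborel (\<lambda>x. (cmod (f x))\<^sup>2 + (cmod (g x))\<^sup>2)"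
    using assms by (auto simp: L2_def)
  ultimately show ?thesis
    by (intro Bochner_Integration.integrable_bound[of _ _ "\<lambda>x. f x * g x"]) auto
qed

text \<open>The bilinear form is chosen because \<open>dist_of\<close> pairs without conjugation;
  the sesquilinear case follows with \<open>L2_norm_cnj\<close>.\<close>

lemma L2_Cauchy_Schwarz:
  assumes "f \<in> L2" "g \<in> L2"
  shows "cmod (LINT x|lborel. f x * g x) \<le> L2_norm f * L2_norm g"
proof -
  have [measurable]: "f \<in> borel_measurable lborel" "g \<in> borel_measurable lborel"
    using assms by (auto simp: L2_def)
  let ?I = "LINT x|lborel. cmod (f x * g x)"
  have sq: "(\<integral>\<^sup>+x. (ennreal (cmod (h x)))\<^sup>2 \<partial>lborel) = ennreal ((L2_norm h)\<^sup>2)" if "h \<in> L2" for h :: "'a cfun"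
    using that by (simp add: L2_norm_def ennreal_power L2_def nn_integral_eq_integral)
  have "(\<integral>\<^sup>+x. ennreal (cmod (f x)) * ennreal (cmod (g x)) \<partial>lborel) = ennreal ?I"
    using integrable_norm[OF L2_mult_integrable[OF assms]]
    by (subst nn_integral_eq_integral[symmetric]) (auto simp: norm_mult ennreal_mult)
  then have "(ennreal ?I)\<^sup>2 \<le> ennreal ((L2_norm f)\<^sup>2) * ennreal ((L2_norm g)\<^sup>2)"
    using Cauchy_Schwarz_nn_integral[of "\<lambda>x. ennreal (cmod (f x))" lborel "\<lambda>x. ennreal (cmod (g x))"]
    by (simp add: sq assms)
  then have "?I\<^sup>2 \<le> (L2_norm f * L2_norm g)\<^sup>2"
    by (simp add: ennreal_power ennreal_mult[symmetric] power_mult_distrib)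
  then have "?I \<le> L2_norm f * L2_norm g"
    by (rule power2_le_imp_le) (simp add: L2_norm_nonneg)
  then show ?thesis
    using integral_norm_bound[of lborel "\<lambda>x. f x * g x"] by linarith
qed

section \<open>Operator norms of maps that are linear up to null sets\<close>

subsection \<open>Bounded operators\<close>

lemma bounded_L2_operatorD:
  assumes "bounded_L2_operator B" "f \<in> L2"
  shows "B f \<in> L2"
    and "g \<in> L2 \<Longrightarrow> AE u in lborel. B (\<lambda>x. f x + g x) u = B f u + B g u"
    and "AE u in lborel. B (\<lambda>x. c * f x) u = c * B f u"
  using assms by (auto simp: bounded_L2_operator_def)

text \<open>Dividing \<open>f\<close> by \<open>c\<close> puts it into the unit ball. A positive
  upper bound \<open>c\<close> in place of \<open>L2_norm f\<close> itself avoids a separate case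
  for norm zero.\<close>

lemma L2_opnorm_bound:
  assumes B: "bounded_L2_operator B" and f: "f \<in> L2" and c: "L2_norm f \<le> c" "c > 0"
  shows "L2_norm (B f) \<le> c * L2_opnorm B"
proof -
  obtain K where K: "\<And>f. f \<in> L2 \<Longrightarrow> L2_norm (B f) \<le> K * L2_norm f"
    using B unfolding bounded_L2_operator_def by blast
  define g where "g = (\<lambda>x. complex_of_real (1 / c) * f x)"
  have g: "g \<in> L2" "L2_norm g \<le> 1"
    unfolding g_def using L2_scale[OF f] c by (auto simp only: L2_norm_scale) (simp add: norm_divide)
  have Bf: "B f \<in> L2" "B g \<in> L2"
    using bounded_L2_operatorD(1)[OF B] f g by auto
  have "AE u in lborel. B g u = complex_of_real (1 / c) * B f u"
    unfolding g_def by (rule bounded_L2_operatorD(3)[OF B f])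
  then have "L2_norm (B g) = L2_norm (\<lambda>u. complex_of_real (1 / c) * B f u)"
    using Bf by (intro L2_norm_cong_AE L2_scale)
  then have "L2_norm (B f) = c * L2_norm (B g)"
    unfolding L2_norm_scale using c by (simp add: norm_divide)
  \<comment> \<open>A real supremum bounds its members only over a bounded set. The sign of
    \<open>K\<close> is not known here, hence the absolute value.\<close>
  moreover have "bdd_above ((\<lambda>f. L2_norm (B f)) ` {f \<in> L2. L2_norm f \<le> 1})"
  proof (rule bdd_aboveI2)
    fix f :: "'a cfun" assume "f \<in> {f \<in> L2. L2_norm f \<le> 1}"
    then show "L2_norm (B f) \<le> \<bar>K\<bar>"
      using K[of f] L2_norm_nonneg[of f]
        mult_mono[OF abs_ge_self[of K], of "L2_norm f" 1] by auto
  qed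
  then have "L2_norm (B g) \<le> L2_opnorm B"
    unfolding L2_opnorm_def using g by (intro cSUP_upper) auto
  ultimately show ?thesis
    using c by simp
qed

lemma L2_opnorm_nonneg:
  assumes "bounded_L2_operator B"
  shows "0 \<le> L2_opnorm B"
proof -
  have "L2_norm (B (\<lambda>_. 0)) \<le> 1 * L2_opnorm B"
    by (rule L2_opnorm_bound[OF assms]) (auto simp: L2_def L2_norm_def)
  then show ?thesis
    using L2_norm_nonneg[of "B (\<lambda>_. 0)"] by simp
qed

lemma bounded_L2_operator_diff:
  assumes B: "bounded_L2_operator B" and f: "f \<in> L2" and g: "g \<in> L2"
  shows "AE u in lborel. B (\<lambda>x. f x - g x) u = B f u - B g u"
proof -
  have "AE u in lborel. B (\<lambda>x. f x + (-1) * g x) u = B f u + B (\<lambda>x. (-1) * g x) u"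
    by (rule bounded_L2_operatorD(2)[OF B f L2_scale[OF g]])
  moreover have "AE u in lborel. B (\<lambda>x. (-1) * g x) u = (-1) * B g u"
    by (rule bounded_L2_operatorD(3)[OF B g])
  ultimately show ?thesis
    by eventually_elim simp
qed

lemma is_L2_extension_L2_extension:
  "L2_bounded A \<Longrightarrow> is_L2_extension A (L2_extension A)"
  unfolding L2_bounded_def L2_extension_def by (rule someI_ex[of "is_L2_extension A"])

lemma operator_norm_nonneg: "L2_bounded A \<Longrightarrow> 0 \<le> operator_norm A"
  using is_L2_extension_L2_extension[of A]
  by (auto simp: operator_norm_def is_L2_extension_def intro: L2_opnorm_nonneg)

section \<open>Schwartz functions inside \<open>L2\<close> and pairings with bounded
  operators\<close>

subsection \<open>Schwartz functions\<close>

text \<open>One factor of the square supplies decay of order d + 1; the other is bounded by the same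
  constant \<open>M\<close>.\<close>

lemma schwartz_subset_L2: "schwartz \<subseteq> L2"
proof
  fix f :: "'n::finite cfun" assume f: "f \<in> schwartz"
  have "partials [] f differentiable (at x)" for x
    using f unfolding schwartz_def smooth_def by blast
  then have "continuous_on UNIV f"
    by (auto simp: partials_def continuous_on_eq_continuous_at differentiable_imp_continuous_within)
  then have meas [measurable]: "f \<in> borel_measurable borel"
    by (rule borel_measurable_continuous_onI)
  define k where "k = DIM(real ^ 'n) + 1"
  have "bdd_above (range (\<lambda>x. (1 + norm x) ^ k * cmod (partials [] f x)))"
    using f by (simp add: schwartz_def)
  then obtain M where M: "\<And>x. (1 + norm x) ^ k * cmod (f x) \<le> M"
    by (auto simp: bdd_above_def partials_def)
  have bound: "(cmod (f x))\<^sup>2 \<le> M\<^sup>2 * (1 / (1 + norm x) ^ k)" for x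
  proof -
    have 1: "1 \<le> (1 + norm x) ^ k"
      by (intro one_le_power) simp
    have "cmod (f x) \<le> (1 + norm x) ^ k * cmod (f x)"
      using mult_right_mono[OF 1 norm_ge_zero[of "f x"]] by simp
    then have "cmod (f x) \<le> M"
      using M[of x] by linarith
    then have "(1 + norm x) ^ k * cmod (f x) * cmod (f x) \<le> M * M"
      using order_trans[OF norm_ge_zero, of "f x" M] by (intro mult_mono M) auto
    then show ?thesis
      using less_le_trans[OF zero_less_one 1] by (simp add: power2_eq_square pos_le_divide_eq mult_ac)
  qed
  have "integrable lborel (\<lambda>x. (cmod (f x))\<^sup>2)"
  proof (rule Bochner_Integration.integrable_bound)
    show "integrable lborel (\<lambda>x::real^'n. M\<^sup>2 * (1 / (1 + norm x) ^ k))"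
      unfolding k_def by (intro integrable_mult_right integrable_power_decay)
  qed (use bound in auto)
  then show "f \<in> L2"
    by (simp add: L2_def)
qed

lemma L2_bounded_pairing_bound:
  assumes A: "L2_bounded A" and f: "f \<in> schwartz" and g: "g \<in> schwartz"
    and c: "L2_norm f \<le> c" "c > 0"
  shows "cmod (A f g) \<le> c * L2_norm g * operator_norm A"
proof -
  have ext: "is_L2_extension A (L2_extension A)"
    by (rule is_L2_extension_L2_extension[OF A])
  have fg: "f \<in> L2" "g \<in> L2" "L2_extension A f \<in> L2"
    using f g ext schwartz_subset_L2 by (auto simp: is_L2_extension_def bounded_L2_operator_def)
  have "cmod (A f g) \<le> L2_norm (L2_extension A f) * L2_norm g"
    using ext f g fg L2_Cauchy_Schwarz[of "L2_extension A f" g]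
    by (simp add: is_L2_extension_def dist_of_def)
  also have "\<dots> \<le> c * operator_norm A * L2_norm g"
    using ext fg c by (intro mult_right_mono)
      (auto simp: is_L2_extension_def operator_norm_def L2_norm_nonneg intro: L2_opnorm_bound)
  finally show ?thesis
    by (simp add: mult_ac)
qed

text \<open>The iterated commutators enter as L2-bounded operators, so homogeneity is read off an
  extension \<open>B\<close>, where it holds almost everywhere and passes to the integral.\<close>

lemma L2_bounded_scale_left:
  assumes A: "L2_bounded A" and f: "f \<in> schwartz" and g: "g \<in> schwartz"
    and cf: "(\<lambda>x. c * f x) \<in> schwartz"
  shows "A (\<lambda>x. c * f x) g = c * A f g"
proof -
  obtain B where B: "is_L2_extension A B"
    using A by (auto simp: L2_bounded_def)
  have fg: "f \<in> L2" "g \<in> L2" "(\<lambda>x. c * f x) \<in> L2" "B f \<in> L2" "B (\<lambda>x. c * f x) \<in> L2"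
    using f g cf B schwartz_subset_L2 by (auto simp: is_L2_extension_def bounded_L2_operator_def)
  then have [measurable]: "g \<in> borel_measurable borel" "B f \<in> borel_measurable borel"
    "B (\<lambda>x. c * f x) \<in> borel_measurable borel"
    by (auto simp: L2_def)
  have "AE u in lborel. B (\<lambda>x. c * f x) u = c * B f u"
    using B fg unfolding is_L2_extension_def bounded_L2_operator_def by blast
  then have "(LINT u|lborel. B (\<lambda>x. c * f x) u * g u) = (LINT u|lborel. c * (B f u * g u))"
    by (intro integral_cong_AE) (auto simp: mult_ac)
  then show ?thesis
    using B f g cf by (simp add: is_L2_extension_def dist_of_def)
qed

text \<open>The second argument is only integrated against the fixed function \<open>B f\<close>.
  The combination has the shape of the recursion in \<open>hermite_state_Suc\<close>.\<close>

lemma L2_bounded_lincomb_right: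
  assumes A: "L2_bounded A" and f: "f \<in> schwartz"
    and g: "g \<in> schwartz" "h \<in> schwartz" "k \<in> schwartz"
    and lin: "(\<lambda>x. g x - h x - c * k x) \<in> schwartz"
  shows "A f (\<lambda>x. g x - h x - c * k x) = A f g - A f h - c * A f k"
proof -
  obtain B where B: "is_L2_extension A B"
    using A by (auto simp: L2_bounded_def)
  have L2: "B f \<in> L2" "g \<in> L2" "h \<in> L2" "k \<in> L2"
    using f g B schwartz_subset_L2 by (auto simp: is_L2_extension_def bounded_L2_operator_def)
  note int = L2_mult_integrable[OF L2(1,2)] L2_mult_integrable[OF L2(1,3)] L2_mult_integrable[OF L2(1,4)]
  have "(LINT u|lborel. B f u * (g u - h u - c * k u))
      = (LINT u|lborel. B f u * g u - B f u * h u - c * (B f u * k u))"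
    by (intro Bochner_Integration.integral_cong) (auto simp: algebra_simps)
  also have "\<dots> = (LINT u|lborel. B f u * g u) - (LINT u|lborel. B f u * h u) - c * (LINT u|lborel. B f u * k u)"
    using int by simp
  finally show ?thesis
    using B f g lin by (simp add: is_L2_extension_def dist_of_def)
qed

section \<open>Derivatives of coherent states and the eigenvalue equation\<close>

subsection \<open>Coherent states\<close>

text \<open>Chain rule along the line through \<open>x\<close> in direction \<open>j\<close>;
  partial derivatives can then be computed from Frechet derivatives.\<close>

lemma partial_eq_derivative:
  assumes "(f has_derivative D) (at x)"
  shows "partial j f x = D (axis j 1)"
proof -
  have "((\<lambda>t. x + t *\<^sub>R axis j 1) has_derivative (\<lambda>t. t *\<^sub>R axis j 1)) (at (0::real))"
    by (auto intro!: derivative_eq_intros)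
  then have "((\<lambda>t. f (x + t *\<^sub>R axis j 1)) has_derivative (\<lambda>t. D (t *\<^sub>R axis j 1))) (at (0::real))"
    by (rule has_derivative_compose) (simp add: assms)
  moreover have "D (t *\<^sub>R axis j 1) = t *\<^sub>R D (axis j 1)" for t
    using linear_scale[OF has_derivative_linear[OF assms]] .
  ultimately show ?thesis
    unfolding partial_def
    by (intro vector_derivative_at) (simp add: has_vector_derivative_def)
qed

lemma coherent_eq:
  "coherent X u = complex_of_real (pi powr (- real CARD('n) / 4)) *
     exp (complex_of_real (- ((u - fst X) \<bullet> (u - fst X)) / 2)
       + \<i> * complex_of_real (u \<bullet> snd X) - \<i> / 2 * complex_of_real (fst X \<bullet> snd X))"
  for u :: "real ^ 'n::finite"
  by (simp add: coherent_def case_prod_beta power2_norm_eq_inner)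

lemma norm_coherent:
  "cmod (coherent X u) = pi powr (- real CARD('n) / 4) * exp (- (norm (u - fst X))\<^sup>2 / 2)"
  for u :: "real ^ 'n::finite"
  by (simp add: coherent_def case_prod_beta norm_mult)

text \<open>Both phase terms are odd in the momentum and the Gaussian factor does not contain it.
  This turns sesquilinear inner products into bilinear pairings.\<close>

lemma cnj_coherent: "cnj (coherent (x, \<xi>) u) = coherent (x, - \<xi>) u"
  by (simp add: coherent_eq exp_cnj) (simp add: algebra_simps)

lemma has_derivative_coherent:
  "(coherent X has_derivative
     (\<lambda>h. (\<i> * complex_of_real (h \<bullet> snd X) - complex_of_real ((u - fst X) \<bullet> h)) * coherent X u)) (at u)"
proof -
  have "((\<lambda>u. - ((u - fst X) \<bullet> (u - fst X)) / 2) has_derivative (\<lambda>h. - ((u - fst X) \<bullet> h))) (at u)"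
    by (auto intro!: derivative_eq_intros simp: inner_commute)
  moreover have "((\<lambda>u. u \<bullet> snd X) has_derivative (\<lambda>h. h \<bullet> snd X)) (at u)"
    by (auto intro!: derivative_eq_intros)
  ultimately have "((\<lambda>u. complex_of_real (- ((u - fst X) \<bullet> (u - fst X)) / 2)
      + \<i> * complex_of_real (u \<bullet> snd X) - \<i> / 2 * complex_of_real (fst X \<bullet> snd X)) has_derivative
      (\<lambda>h. complex_of_real (- ((u - fst X) \<bullet> h)) + \<i> * complex_of_real (h \<bullet> snd X) - 0)) (at u)"
    by (intro has_derivative_add has_derivative_diff has_derivative_of_real has_derivative_mult_right
        has_derivative_const)
  from has_derivative_mult_right[OF has_derivative_compose[OF this DERIV_exp[unfolded has_field_derivative_def]],
      of "complex_of_real (pi powr (- real CARD('a) / 4))"]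
  show ?thesis
    unfolding coherent_eq by (rule has_derivative_eq_rhs) (simp add: fun_eq_iff algebra_simps)
qed

lemma partial_coherent:
  "partial j (coherent X) u
     = (complex_of_real (fst X $ j) + \<i> * complex_of_real (snd X $ j) - complex_of_real (u $ j)) * coherent X u"
  unfolding partial_eq_derivative[OF has_derivative_coherent]
  by (simp add: inner_axis inner_axis' algebra_simps)

text \<open>Differentiation produces the factor z_j - u_j, and multiplication by u_j cancels its
  variable part.\<close>

lemma a_fun_coherent:
  "a_fun j (coherent X)
     = (\<lambda>u. (complex_of_real (fst X $ j) + \<i> * complex_of_real (snd X $ j)) * coherent X u)"
  by (rule ext) (simp add: a_fun_def mult_coord_def partial_coherent algebra_simps)

section \<open>Polynomials times a coherent state, and their Schwartz property\<close>

text \<open>These are the complex polynomials times \<open>coherent X\<close>. Generating them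
  inductively lets differentiability, closure under \<open>partial\<close> and decay each be proved
  by one induction.\<close>

inductive_set coherent_poly :: "(real ^ 'n::finite) \<times> (real ^ 'n) \<Rightarrow> 'n cfun set" for X where
  base: "coherent X \<in> coherent_poly X"
| scale: "f \<in> coherent_poly X \<Longrightarrow> (\<lambda>u. c * f u) \<in> coherent_poly X"
| add: "f \<in> coherent_poly X \<Longrightarrow> g \<in> coherent_poly X \<Longrightarrow> (\<lambda>u. f u + g u) \<in> coherent_poly X"
| mult: "f \<in> coherent_poly X \<Longrightarrow> mult_coord j f \<in> coherent_poly X"

lemma coherent_poly_diff:
  "f \<in> coherent_poly X \<Longrightarrow> g \<in> coherent_poly X \<Longrightarrow> (\<lambda>u. f u - g u) \<in> coherent_poly X"
  using coherent_poly.add[of f X "\<lambda>u. (-1) * g u"] coherent_poly.scale[of g X "-1"] by simp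

lemma has_derivative_mult_coord:
  assumes "(f has_derivative D) (at u)"
  shows "(mult_coord j f has_derivative
    (\<lambda>h. complex_of_real (u $ j) * D h + complex_of_real (h $ j) * f u)) (at u)"
  unfolding mult_coord_def
  by (auto intro!: derivative_eq_intros assms bounded_linear.has_derivative[OF bounded_linear_vec_nth])

lemma coherent_poly_differentiable:
  "f \<in> coherent_poly X \<Longrightarrow> f differentiable (at u)"
proof (induction rule: coherent_poly.induct)
  case base
  show ?case by (rule differentiableI[OF has_derivative_coherent])
next
  case (mult f j)
  then show ?case using has_derivative_mult_coord by (meson differentiable_def)
qed auto

lemma coherent_poly_partial:
  "f \<in> coherent_poly X \<Longrightarrow> partial j f \<in> coherent_poly X"
proof (induction rule: coherent_poly.induct)
  case base
  have "partial j (coherent X) = (\<lambda>u. (complex_of_real (fst X $ j) + \<i> * complex_of_real (snd X $ j)) * coherent X u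
      - mult_coord j (coherent X) u)"
    by (rule ext) (simp add: partial_coherent mult_coord_def algebra_simps)
  then show ?case
    by (simp only:) (intro coherent_poly.intros coherent_poly_diff)
next
  case (scale f c)
  have "partial j (\<lambda>u. c * f u) = (\<lambda>u. c * partial j f u)"
  proof
    fix u
    obtain D where D: "(f has_derivative D) (at u)"
      using coherent_poly_differentiable[OF scale.hyps] by (auto simp: differentiable_def)
    show "partial j (\<lambda>u. c * f u) u = c * partial j f u"
      by (simp add: partial_eq_derivative[OF D] partial_eq_derivative[OF has_derivative_mult_right[OF D]])
  qed
  then show ?case
    using scale.IH by (simp add: coherent_poly.scale)
next
  case (add f g)
  have "partial j (\<lambda>u. f u + g u) = (\<lambda>u. partial j f u + partial j g u)"
  proof
    fix u
    obtain D E where D: "(f has_derivative D) (at u)" "(g has_derivative E) (at u)"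
      using coherent_poly_differentiable add.hyps by (meson differentiable_def)
    show "partial j (\<lambda>u. f u + g u) u = partial j f u + partial j g u"
      by (simp add: partial_eq_derivative[OF D(1)] partial_eq_derivative[OF D(2)]
          partial_eq_derivative[OF has_derivative_add[OF D]])
  qed
  then show ?case
    using add.IH by (simp add: coherent_poly.add)
next
  case (mult f k)
  have "partial j (mult_coord k f)
      = (\<lambda>u. mult_coord k (partial j f) u + complex_of_real (axis j 1 $ k) * f u)"
  proof
    fix u
    obtain D where D: "(f has_derivative D) (at u)"
      using coherent_poly_differentiable[OF mult.hyps] by (auto simp: differentiable_def)
    show "partial j (mult_coord k f) u
        = mult_coord k (partial j f) u + complex_of_real (axis j 1 $ k) * f u"
      unfolding partial_eq_derivative[OF has_derivative_mult_coord[OF D]]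
      by (simp add: partial_eq_derivative[OF D] mult_coord_def)
  qed
  then show ?case
    using mult by (simp add: coherent_poly.add coherent_poly.mult coherent_poly.scale)
qed

text \<open>With s = |u - x|, the weight splits as 1 + |u| \<le> (1 + |x|)(1 + s). The power of 1 +
  s is at most k! exp(1 + s), by keeping a single term of the exponential series, and the Gaussian
  absorbs this exponential.\<close>

lemma power_gaussian_bound:
  fixes u x :: "'a::real_normed_vector"
  shows "(1 + norm u) ^ k * exp (- (norm (u - x))\<^sup>2 / 2) \<le> (1 + norm x) ^ k * (fact k * exp (3 / 2))"
proof -
  define s where "s = norm (u - x)"
  have s: "s \<ge> 0" by (simp add: s_def)
  have "norm u \<le> norm x + s"
    using norm_triangle_ineq[of x "u - x"] by (simp add: s_def)
  moreover have "0 \<le> norm x * s"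
    using s by simp
  ultimately have "1 + norm u \<le> (1 + norm x) * (1 + s)"
    by (simp add: algebra_simps)
  then have 1: "(1 + norm u) ^ k \<le> (1 + norm x) ^ k * (1 + s) ^ k"
    by (metis add_nonneg_nonneg norm_ge_zero power_mono power_mult_distrib zero_le_one)
  have "(1 + s) ^ k / fact k \<le> (\<Sum>i\<le>k. (1 + s) ^ i / fact i)"
    using s by (intro member_le_sum) auto
  also have "\<dots> = (\<Sum>i\<in>{..k}. inverse (fact i) * (1 + s) ^ i)"
    by (simp add: field_simps)
  also have "\<dots> \<le> exp (1 + s)"
    unfolding exp_def real_scaleR_def using s summable_exp[of "1 + s"]
    by (intro sum_le_suminf) auto
  finally have "(1 + s) ^ k \<le> fact k * exp (1 + s)"
    by (simp add: field_simps)
  then have "(1 + s) ^ k * exp (- s\<^sup>2 / 2) \<le> fact k * exp (1 + s) * exp (- s\<^sup>2 / 2)"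
    by (rule mult_right_mono) simp
  also have "\<dots> = fact k * exp (1 + s - s\<^sup>2 / 2)"
    by (simp add: exp_add[symmetric] exp_diff exp_minus field_simps)
  \<comment> \<open>Completing the square: 3/2 - (1 + s - s^2/2) = (s - 1)^2/2.\<close>
  also have "\<dots> \<le> fact k * exp (3 / 2)"
    using zero_le_power2[of "s - 1"] by (simp add: power2_diff)
  finally have "(1 + norm x) ^ k * ((1 + s) ^ k * exp (- s\<^sup>2 / 2)) \<le> (1 + norm x) ^ k * (fact k * exp (3 / 2))"
    by (intro mult_left_mono) auto
  moreover have "(1 + norm u) ^ k * exp (- s\<^sup>2 / 2) \<le> (1 + norm x) ^ k * ((1 + s) ^ k * exp (- s\<^sup>2 / 2))"
    using mult_right_mono[OF 1, of "exp (- s\<^sup>2 / 2)"] by (simp add: mult.assoc)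
  ultimately show ?thesis
    unfolding s_def[symmetric] by (rule order_trans[rotated])
qed

text \<open>The induction leaves \<open>k\<close> arbitrary because multiplication by a coordinate
  consumes one extra power of the weight.\<close>

lemma coherent_poly_bounded:
  "f \<in> coherent_poly X \<Longrightarrow> \<exists>M. \<forall>u. (1 + norm u) ^ k * cmod (f u) \<le> M"
proof (induction arbitrary: k rule: coherent_poly.induct)
  case base
  let ?p = "pi powr (- real CARD('a) / 4)"
  have "(1 + norm u) ^ k * cmod (coherent X u) \<le> ?p * ((1 + norm (fst X)) ^ k * (fact k * exp (3 / 2)))" for u
    using mult_left_mono[OF power_gaussian_bound[of u k "fst X"], of ?p]
    by (simp add: norm_coherent mult_ac)
  then show ?case by blast
next
  case (scale f c)
  obtain M where M: "\<And>u. (1 + norm u) ^ k * cmod (f u) \<le> M"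
    using scale.IH by blast
  have "(1 + norm u) ^ k * cmod (c * f u) \<le> cmod c * M" for u
    using mult_left_mono[OF M[of u], of "cmod c"] by (simp add: norm_mult mult_ac)
  then show ?case by blast
next
  case (add f g)
  obtain M N where M: "\<And>u. (1 + norm u) ^ k * cmod (f u) \<le> M"
    and N: "\<And>u. (1 + norm u) ^ k * cmod (g u) \<le> N"
    using add.IH by meson
  have "(1 + norm u) ^ k * cmod (f u + g u) \<le> M + N" for u
    using mult_left_mono[OF norm_triangle_ineq[of "f u" "g u"], of "(1 + norm u) ^ k"] M[of u] N[of u]
    by (simp add: distrib_left)
  then show ?case by blast
next
  case (mult f j)
  obtain M where M: "\<And>u. (1 + norm u) ^ Suc k * cmod (f u) \<le> M"
    using mult.IH by blast
  have "(1 + norm u) ^ k * cmod (mult_coord j f u) \<le> M" for u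
  proof -
    have "\<bar>u $ j\<bar> \<le> 1 + norm u"
      using component_le_norm_cart[of u j] by linarith
    then have "(1 + norm u) ^ k * cmod (f u) * \<bar>u $ j\<bar> \<le> (1 + norm u) ^ k * cmod (f u) * (1 + norm u)"
      by (rule mult_left_mono) simp
    then show ?thesis
      using M[of u] by (simp add: mult_coord_def norm_mult mult_ac)
  qed
  then show ?case by blast
qed

text \<open>Closure under \<open>partial\<close> reduces smoothness and rapid decay of all
  derivatives to properties of the members themselves.\<close>

lemma coherent_poly_schwartz:
  assumes "f \<in> coherent_poly X"
  shows "f \<in> schwartz"
proof -
  have *: "partials js f \<in> coherent_poly X" for js
    using assms by (induction js) (auto simp: partials_def coherent_poly_partial)
  then show ?thesis
    using coherent_poly_differentiable[OF *] coherent_poly_bounded[OF *]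
    unfolding schwartz_def smooth_def bdd_above_def by fast
qed

section \<open>Hermite polynomials in one direction times a coherent state\<close>

subsection \<open>Hermite states\<close>

text \<open>The physicists' Hermite polynomials, with leading coefficient 2^m.\<close>

fun hermite :: "nat \<Rightarrow> real poly" where
  "hermite 0 = 1"
| "hermite (Suc m) = [:0, 2:] * hermite m - pderiv (hermite m)"

definition hermite_state :: "'n::finite \<Rightarrow> nat \<Rightarrow> (real ^ 'n) \<times> (real ^ 'n) \<Rightarrow> 'n cfun" where
  "hermite_state j m X = (\<lambda>u. complex_of_real (poly (hermite m) (u $ j - fst X $ j)) * coherent X u)"

lemma hermite_state_0: "hermite_state j 0 X = coherent X"
  by (simp add: hermite_state_def)

lemma partial_poly_coherent:
  "partial j (\<lambda>u. complex_of_real (poly p (u $ j - fst X $ j)) * coherent X u) u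
     = complex_of_real (poly (pderiv p) (u $ j - fst X $ j)) * coherent X u
       + complex_of_real (poly p (u $ j - fst X $ j)) * partial j (coherent X) u"
proof -
  have "((\<lambda>u. u $ j - fst X $ j) has_derivative (\<lambda>h. h $ j)) (at u)"
    by (auto intro!: derivative_eq_intros bounded_linear.has_derivative[OF bounded_linear_vec_nth])
  then have "((\<lambda>u. poly p (u $ j - fst X $ j)) has_derivative
      (\<lambda>h. h $ j * poly (pderiv p) (u $ j - fst X $ j))) (at u)"
    using has_derivative_compose[of _ _ _ UNIV "poly p"] poly_DERIV[of p]
    by (fastforce simp: has_field_derivative_def mult.commute)
  then have "((\<lambda>u. complex_of_real (poly p (u $ j - fst X $ j)) * coherent X u) has_derivative
      (\<lambda>h. complex_of_real (poly p (u $ j - fst X $ j))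
          * ((\<i> * complex_of_real (h \<bullet> snd X) - complex_of_real ((u - fst X) \<bullet> h)) * coherent X u)
        + complex_of_real (h $ j * poly (pderiv p) (u $ j - fst X $ j)) * coherent X u)) (at u)"
    by (intro has_derivative_mult[OF has_derivative_of_real has_derivative_coherent])
  from partial_eq_derivative[OF this, of j] partial_eq_derivative[OF has_derivative_coherent[of X u], of j]
  show ?thesis
    by simp
qed

text \<open>For a state p(t) times the coherent state, with t = u_j - x_j, the momentum terms cancel
  and 2 t p - p' remains, which is the Hermite recursion.\<close>

lemma hermite_state_Suc:
  "hermite_state j (Suc m) X = (\<lambda>u. mult_coord j (hermite_state j m X) u - partial j (hermite_state j m X) u
     - (complex_of_real (fst X $ j) - \<i> * complex_of_real (snd X $ j)) * hermite_state j m X u)"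
  unfolding hermite_state_def
  by (rule ext, simp only: partial_poly_coherent partial_coherent mult_coord_def hermite.simps)
    (simp add: algebra_simps)

lemma hermite_state_coherent_poly: "hermite_state j m X \<in> coherent_poly X"
proof (induction m)
  case 0
  then show ?case by (simp add: hermite_state_0 coherent_poly.base)
next
  case (Suc m)
  then show ?case
    unfolding hermite_state_Suc
    by (intro coherent_poly_diff coherent_poly.mult coherent_poly.scale coherent_poly_partial)
qed

lemma hermite_state_schwartz: "hermite_state j m X \<in> schwartz"
  by (rule coherent_poly_schwartz[OF hermite_state_coherent_poly])

lemma coherent_schwartz: "coherent X \<in> schwartz"
  by (rule coherent_poly_schwartz[OF coherent_poly.base])

lemma coherent_L2: "coherent X \<in> L2"
  using coherent_schwartz schwartz_subset_L2 by blast

text \<open>The phases have modulus 1 and the rest depends on \<open>X\<close> only through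
  translation by \<open>fst X\<close>. This uniformity keeps the final constant independent of the
  phase-space points.\<close>

lemma L2_norm_hermite_state: "L2_norm (hermite_state j m X) = L2_norm (hermite_state j m 0)"
  for j :: "'n::finite"
proof -
  let ?h = "\<lambda>u. (cmod (hermite_state j m (0 :: (real^'n) \<times> (real^'n)) u))\<^sup>2"
  have "hermite_state j m (0 :: (real^'n) \<times> (real^'n)) \<in> L2"
    using hermite_state_schwartz schwartz_subset_L2 by blast
  then have [measurable]: "?h \<in> borel_measurable borel"
    by (auto simp: L2_def)
  have "(LINT u|lborel. ?h u) = (LINT u|distr lborel borel ((+) (- fst X)). ?h u)"
    by (simp add: lborel_distr_plus)
  also have "\<dots> = (LINT u|lborel. ?h (- fst X + u))"
    by (subst integral_distr) auto
  also have "\<dots> = (LINT u|lborel. (cmod (hermite_state j m X u))\<^sup>2)"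
    by (simp add: hermite_state_def norm_mult norm_coherent)
  finally show ?thesis
    by (simp add: L2_norm_def)
qed

lemma L2_norm_coherent: "L2_norm (coherent X) = L2_norm (coherent (0 :: (real ^ 'n) \<times> (real ^ 'n)))"
  for X :: "(real ^ 'n::finite) \<times> (real ^ 'n)"
  using L2_norm_hermite_state[of _ 0 X] by (simp add: hermite_state_0)

section \<open>Norm continuity of coherent states and continuity of the matrix elements\<close>

subsection \<open>Continuity of coherent states\<close>

text \<open>Dominated convergence: a convergent sequence of parameters is bounded, so all the
  Gaussians share one integrable majorant.\<close>

lemma coherent_L2_tendsto:
  fixes Y :: "nat \<Rightarrow> (real ^ 'n::finite) \<times> (real ^ 'n)"
  assumes Y: "Y \<longlonglongrightarrow> Y0"
  shows "(\<lambda>i. L2_norm (\<lambda>u. coherent (Y i) u - coherent Y0 u)) \<longlonglongrightarrow> 0"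
proof -
  define k where "k = DIM(real ^ 'n) + 1"
  define p where "p = pi powr (- real CARD('n) / 4)"
  define K where "K = fact k * exp (3 / 2 :: real)"
  have bound: "(cmod (coherent X u))\<^sup>2 \<le> p\<^sup>2 * ((1 + R) ^ k * K) * (1 / (1 + norm u) ^ k)"
    if "norm X \<le> R" for X :: "(real ^ 'n) \<times> (real ^ 'n)" and u and R
  proof -
    have "norm (fst X) \<le> R"
      using that norm_fst_le[of "fst X" "snd X"] by simp
    then have R: "(1 + norm (fst X)) ^ k * K \<le> (1 + R) ^ k * K"
      by (intro mult_right_mono power_mono) (auto simp: K_def)
    have "(cmod (coherent X u))\<^sup>2 = p\<^sup>2 * exp (- (norm (u - fst X))\<^sup>2)"
      by (simp add: norm_coherent p_def power_mult_distrib power2_eq_square[of "exp _"] exp_add[symmetric])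
    also have "\<dots> \<le> p\<^sup>2 * exp (- (norm (u - fst X))\<^sup>2 / 2)"
      by (intro mult_left_mono) auto
    also have "\<dots> \<le> p\<^sup>2 * (((1 + R) ^ k * K) / (1 + norm u) ^ k)"
    proof (rule mult_left_mono)
      have "0 < (1 + norm u) ^ k"
        by (intro zero_less_power add_pos_nonneg) auto
      moreover have "(1 + norm u) ^ k * exp (- (norm (u - fst X))\<^sup>2 / 2) \<le> (1 + R) ^ k * K"
        using power_gaussian_bound[of u k "fst X"] R unfolding K_def by (rule order_trans)
      ultimately show "exp (- (norm (u - fst X))\<^sup>2 / 2) \<le> (1 + R) ^ k * K / (1 + norm u) ^ k"
        by (simp only: pos_le_divide_eq mult.commute)
    qed simp
    finally show ?thesis
      by simp
  qed
  obtain R1 where R1: "\<And>i. norm (Y i) \<le> R1"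
    using convergent_imp_Bseq[OF convergentI[OF Y]] by (auto simp: Bseq_def)
  define R where "R = max R1 (norm Y0)"
  have R: "norm (Y i) \<le> R" "norm Y0 \<le> R" for i
    using R1[of i] by (auto simp: R_def)
  \<comment> \<open>The factor 4 comes from |a - b|^2 \<le> 2 |a|^2 + 2 |b|^2 with the same bound
    for both terms.\<close>
  define M where "M = 4 * (p\<^sup>2 * ((1 + R) ^ k * K))"
  have dom: "(cmod (coherent (Y i) u - coherent Y0 u))\<^sup>2 \<le> M * (1 / (1 + norm u) ^ k)" for i u
  proof -
    have "(cmod (coherent (Y i) u - coherent Y0 u))\<^sup>2 \<le> (cmod (coherent (Y i) u) + cmod (coherent Y0 u))\<^sup>2"
      by (intro power_mono norm_triangle_ineq4) auto
    also have "\<dots> \<le> 2 * (cmod (coherent (Y i) u))\<^sup>2 + 2 * (cmod (coherent Y0 u))\<^sup>2"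
      using sum_squares_bound[of "cmod (coherent (Y i) u)" "cmod (coherent Y0 u)"] by (simp add: power2_sum)
    also have "\<dots> \<le> 2 * (p\<^sup>2 * ((1 + R) ^ k * K) * (1 / (1 + norm u) ^ k))
        + 2 * (p\<^sup>2 * ((1 + R) ^ k * K) * (1 / (1 + norm u) ^ k))"
      by (intro add_mono mult_left_mono bound R) simp_all
    also have "\<dots> = M * (1 / (1 + norm u) ^ k)"
      by (simp add: M_def)
    finally show ?thesis .
  qed
  have [measurable]: "coherent X \<in> borel_measurable borel" for X :: "(real ^ 'n) \<times> (real ^ 'n)"
    using coherent_L2[of X] by (simp add: L2_def)
  have "(\<lambda>i. LINT u|lborel. (cmod (coherent (Y i) u - coherent Y0 u))\<^sup>2) \<longlonglongrightarrow> (LINT u|(lborel :: (real^'n) measure). 0)"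
  proof (rule integral_dominated_convergence)
    show "integrable lborel (\<lambda>u::real^'n. M * (1 / (1 + norm u) ^ k))"
      unfolding k_def by (intro integrable_mult_right integrable_power_decay)
    show "AE u in lborel. (\<lambda>i. (cmod (coherent (Y i) u - coherent Y0 u))\<^sup>2) \<longlonglongrightarrow> 0"
    proof (rule AE_I2)
      fix u :: "real ^ 'n"
      have "(\<lambda>i. coherent (Y i) u) \<longlonglongrightarrow> coherent Y0 u"
        unfolding coherent_eq by (intro tendsto_intros Y) auto
      then have "(\<lambda>i. (cmod (coherent (Y i) u - coherent Y0 u))\<^sup>2) \<longlonglongrightarrow> (cmod (coherent Y0 u - coherent Y0 u))\<^sup>2"
        by (intro tendsto_intros)
      then show "(\<lambda>i. (cmod (coherent (Y i) u - coherent Y0 u))\<^sup>2) \<longlonglongrightarrow> 0"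
        by simp
    qed
  qed (use dom in auto)
  then show ?thesis
    unfolding L2_norm_def using tendsto_real_sqrt by fastforce
qed

text \<open>The difference of two matrix elements splits into \<open>B\<close> of a difference
  paired with the moving state, plus \<open>B\<close> of the limit state paired with a difference.
  Continuity later supplies the measurability of the integrand.\<close>

lemma continuous_on_L2_inner_coherent:
  assumes B: "bounded_L2_operator B"
    and F: "continuous_on UNIV F" and G: "continuous_on UNIV G"
  shows "continuous_on UNIV (\<lambda>Z::'a::metric_space. L2_inner (B (coherent (F Z))) (coherent (G Z)))"
  unfolding continuous_on_sequentially
proof (intro ballI allI impI, elim conjE)
  fix Z and Z0 :: 'a assume Z: "Z \<longlonglongrightarrow> Z0"
  obtain K where K: "\<And>f. f \<in> L2 \<Longrightarrow> L2_norm (B f) \<le> K * L2_norm f"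
    using B unfolding bounded_L2_operator_def by blast
  let ?f = "\<lambda>i. coherent (F (Z i))" and ?fz = "coherent (F Z0)"
  let ?g = "\<lambda>i. coherent (G (Z i))" and ?gz = "coherent (G Z0)"
  let ?df = "\<lambda>i u. ?f i u - ?fz u" and ?dg = "\<lambda>i u. ?g i u - ?gz u"
  let ?c = "L2_norm ?gz"
  have "(\<lambda>i. F (Z i)) \<longlonglongrightarrow> F Z0" "(\<lambda>i. G (Z i)) \<longlonglongrightarrow> G Z0"
    using F G Z by (auto simp: continuous_on_eq_continuous_at intro: isCont_tendsto_compose)
  then have "(\<lambda>i. K * L2_norm (?df i) * ?c + L2_norm (B ?fz) * L2_norm (?dg i))
      \<longlonglongrightarrow> K * 0 * ?c + L2_norm (B ?fz) * 0"
    by (intro tendsto_intros coherent_L2_tendsto)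
  then have lim: "(\<lambda>i. K * L2_norm (?df i) * ?c + L2_norm (B ?fz) * L2_norm (?dg i)) \<longlonglongrightarrow> 0"
    by simp
  have "cmod (L2_inner (B (?f i)) (?g i) - L2_inner (B ?fz) ?gz)
      \<le> K * L2_norm (?df i) * ?c + L2_norm (B ?fz) * L2_norm (?dg i)" for i
  proof -
    have L2: "?f i \<in> L2" "?fz \<in> L2" "?df i \<in> L2" "?g i \<in> L2" "?gz \<in> L2" "?dg i \<in> L2"
      by (simp_all add: coherent_L2 L2_diff)
    have BL2: "B (?f i) \<in> L2" "B ?fz \<in> L2" "B (?df i) \<in> L2"
      using bounded_L2_operatorD(1)[OF B] L2 by auto
    have CL2: "(\<lambda>u. cnj (?g i u)) \<in> L2" "(\<lambda>u. cnj (?gz u)) \<in> L2" "(\<lambda>u. cnj (?dg i u)) \<in> L2"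
      by (intro L2_cnj L2)+
    have [measurable]: "B (?f i) \<in> borel_measurable borel" "B ?fz \<in> borel_measurable borel"
        "B (?df i) \<in> borel_measurable borel" "(\<lambda>u. cnj (?g i u)) \<in> borel_measurable borel"
      using BL2 CL2 by (auto simp: L2_def)
    have "AE u in lborel. B (?df i) u = B (?f i) u - B ?fz u"
      by (rule bounded_L2_operator_diff[OF B L2(1,2)])
    then have "(LINT u|lborel. B (?df i) u * cnj (?g i u))
        = (LINT u|lborel. B (?f i) u * cnj (?g i u) - B ?fz u * cnj (?g i u))"
      by (intro integral_cong_AE) (auto simp: left_diff_distrib elim!: eventually_mono)
    also have "\<dots> = L2_inner (B (?f i)) (?g i) - (LINT u|lborel. B ?fz u * cnj (?g i u))"
      unfolding L2_inner_def
      by (intro Bochner_Integration.integral_diff L2_mult_integrable BL2 CL2)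
    finally have 1: "L2_inner (B (?f i)) (?g i)
        = (LINT u|lborel. B (?df i) u * cnj (?g i u)) + (LINT u|lborel. B ?fz u * cnj (?g i u))"
      by simp
    have "(LINT u|lborel. B ?fz u * cnj (?dg i u))
        = (LINT u|lborel. B ?fz u * cnj (?g i u) - B ?fz u * cnj (?gz u))"
      by (simp add: algebra_simps)
    also have "\<dots> = (LINT u|lborel. B ?fz u * cnj (?g i u)) - L2_inner (B ?fz) ?gz"
      unfolding L2_inner_def
      by (intro Bochner_Integration.integral_diff L2_mult_integrable BL2 CL2)
    finally have "L2_inner (B (?f i)) (?g i) - L2_inner (B ?fz) ?gz
        = (LINT u|lborel. B (?df i) u * cnj (?g i u)) + (LINT u|lborel. B ?fz u * cnj (?dg i u))"
      using 1 by simp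
    then have "cmod (L2_inner (B (?f i)) (?g i) - L2_inner (B ?fz) ?gz)
        \<le> cmod (LINT u|lborel. B (?df i) u * cnj (?g i u)) + cmod (LINT u|lborel. B ?fz u * cnj (?dg i u))"
      by (simp add: norm_triangle_ineq)
    also have "\<dots> \<le> L2_norm (B (?df i)) * L2_norm (\<lambda>u. cnj (?g i u))
        + L2_norm (B ?fz) * L2_norm (\<lambda>u. cnj (?dg i u))"
      by (intro add_mono L2_Cauchy_Schwarz BL2 CL2)
    \<comment> \<open>The norm of the moving state may be replaced by \<open>?c\<close> since all
      coherent states have the same norm.\<close>
    also have "\<dots> \<le> K * L2_norm (?df i) * ?c + L2_norm (B ?fz) * L2_norm (?dg i)"
      unfolding L2_norm_cnj
      using K[OF L2(3)] L2_norm_coherent[of "G (Z i)"] L2_norm_coherent[of "G Z0"]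
      by (intro add_mono mult_mono) (auto simp: L2_norm_nonneg intro: order_trans[OF L2_norm_nonneg])
    finally show ?thesis .
  qed
  then have "(\<lambda>i. L2_inner (B (?f i)) (?g i) - L2_inner (B ?fz) ?gz) \<longlonglongrightarrow> 0"
    by (intro Lim_null_comparison[OF always_eventually[OF allI] lim])
  then show "((\<lambda>Z. L2_inner (B (coherent (F Z))) (coherent (G Z))) \<circ> Z) \<longlonglongrightarrow> L2_inner (B ?fz) ?gz"
    unfolding o_def by (rule LIM_zero_cancel)
qed

section \<open>From commutator recurrences to decay of the matrix elements\<close>

subsection \<open>Commutators and decay\<close>

text \<open>The point \<open>(w, - \<omega>)\<close> encodes the conjugate of the coherent state at
  \<open>(w, \<omega>)\<close>. Moving a(V_j) onto the Hermite state raises its order and leaves the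
  scalar w_j + i \<omega>_j; on the coherent state it gives the eigenvalue y_j + i \<eta>_j, which
  is subtracted.\<close>

lemma ad_a_pairing:
  assumes A: "L2_bounded A"
  shows "ad_a j A (coherent (y, \<eta>)) (hermite_state j m (w, - \<omega>))
    = A (coherent (y, \<eta>)) (hermite_state j (Suc m) (w, - \<omega>))
      + Complex ((w - y) $ j) ((\<omega> - \<eta>) $ j) * A (coherent (y, \<eta>)) (hermite_state j m (w, - \<omega>))"
proof -
  let ?f = "coherent (y, \<eta>)" and ?\<psi> = "hermite_state j m (w, - \<omega>)"
  let ?z = "complex_of_real (y $ j) + \<i> * complex_of_real (\<eta> $ j)"
  let ?c = "complex_of_real (fst (w, - \<omega>) $ j) - \<i> * complex_of_real (snd (w, - \<omega>) $ j)"
  have "A (a_fun j ?f) ?\<psi> = ?z * A ?f ?\<psi>"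
    unfolding a_fun_coherent fst_conv snd_conv
    by (intro L2_bounded_scale_left[OF A] coherent_schwartz hermite_state_schwartz
        coherent_poly_schwartz[OF coherent_poly.scale[OF coherent_poly.base]])
  moreover have "A ?f (hermite_state j (Suc m) (w, - \<omega>))
      = A ?f (mult_coord j ?\<psi>) - A ?f (partial j ?\<psi>) - ?c * A ?f ?\<psi>"
    unfolding hermite_state_Suc
    by (intro L2_bounded_lincomb_right[OF A] coherent_schwartz hermite_state_schwartz)
      (auto intro!: coherent_poly_schwartz[of _ "(w, - \<omega>)"] coherent_poly_diff coherent_poly.mult
        coherent_poly.scale coherent_poly_partial hermite_state_coherent_poly)
  ultimately show ?thesis
    by (simp add: ad_a_def a_dist_def dist_mult_coord_def dist_partial_def Complex_eq algebra_simps)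
qed

text \<open>The recurrence, solved for \<zeta> M k m, trades each factor \<zeta> for two terms, one
  with \<open>k\<close> and one with \<open>m\<close> raised by 1. After \<open>r\<close> trades
  there are 2^r terms, all with indices within \<open>N\<close>.\<close>

lemma iterated_recurrence_bound:
  fixes M :: "nat \<Rightarrow> nat \<Rightarrow> complex"
  assumes rec: "\<And>k m. k < N \<Longrightarrow> m < N \<Longrightarrow> M (Suc k) m = M k (Suc m) + \<zeta> * M k m"
    and bound: "\<And>k m. k \<le> N \<Longrightarrow> m \<le> N \<Longrightarrow> cmod (M k m) \<le> L"
    and "k + r \<le> N" "m + r \<le> N"
  shows "cmod \<zeta> ^ r * cmod (M k m) \<le> 2 ^ r * L"
  using assms(3,4)
proof (induction r arbitrary: k m)
  case 0
  then show ?case using bound[of k m] by simp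
next
  case (Suc r)
  have "\<zeta> * M k m = M (Suc k) m - M k (Suc m)"
    using rec[of k m] Suc.prems by simp
  then have "cmod \<zeta> * cmod (M k m) \<le> cmod (M (Suc k) m) + cmod (M k (Suc m))"
    by (metis norm_mult norm_triangle_ineq4)
  then have "cmod \<zeta> ^ r * (cmod \<zeta> * cmod (M k m)) \<le> cmod \<zeta> ^ r * (cmod (M (Suc k) m) + cmod (M k (Suc m)))"
    by (rule mult_left_mono) simp
  also have "\<dots> \<le> 2 ^ r * L + 2 ^ r * L"
    unfolding distrib_left using Suc.prems by (intro add_mono Suc.IH) auto
  finally show ?case
    by (simp add: mult_ac)
qed

lemma ad_a_multi_single:
  "ad_a_multi (\<lambda>i. if i = j then k else 0) A = (ad_a j ^^ k) A"
proof -
  have "distinct xs \<Longrightarrow> foldr (\<lambda>i. ad_a i ^^ (if i = j then k else 0)) xs A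
      = (if j \<in> set xs then (ad_a j ^^ k) A else A)" for xs
    by (induction xs) auto
  then show ?thesis
    by (simp add: ad_a_multi_def)
qed

text \<open>A sum over an infinite set is 0 by convention; finiteness is what lets the sum of
  operator norms dominate each of its terms.\<close>

lemma finite_multi_indices: "finite {\<alpha> :: 'n::finite \<Rightarrow> nat. (\<Sum>j\<in>UNIV. \<alpha> j) \<le> N}"
proof (rule finite_subset)
  show "{\<alpha> :: 'n \<Rightarrow> nat. (\<Sum>j\<in>UNIV. \<alpha> j) \<le> N} \<subseteq> Pi\<^sub>E UNIV (\<lambda>_. {..N})"
  proof
    fix \<alpha> :: "'n \<Rightarrow> nat" assume "\<alpha> \<in> {\<alpha>. (\<Sum>j\<in>UNIV. \<alpha> j) \<le> N}"
    then have "\<alpha> j \<le> N" for j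
      using member_le_sum[of j UNIV \<alpha>] by simp
    then show "\<alpha> \<in> Pi\<^sub>E UNIV (\<lambda>_. {..N})"
      by auto
  qed
qed (auto intro: finite_PiE)

lemma L2_inner_coherent:
  assumes "L2_bounded A"
  shows "L2_inner (L2_extension A (coherent X)) (coherent Y) = A (coherent X) (coherent (fst Y, - snd Y))"
proof -
  have "cnj (coherent Y u) = coherent (fst Y, - snd Y) u" for u
    using cnj_coherent[of "fst Y" "snd Y"] by simp
  then show ?thesis
    using is_L2_extension_L2_extension[OF assms]
    by (simp add: L2_inner_def is_L2_extension_def dist_of_def coherent_schwartz)
qed

text \<open>Only powers of a single \<open>ad a(V\<^sub>j)\<close> are needed: choosing \<open>j\<close> with \<open>n\<bar>z\<^sub>j\<bar> \<ge> \<bar>Z\<bar>\<close>,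
  where \<open>z\<^sub>j\<close> is the \<open>j\<close>-th complex coordinate of \<open>Z\<close>, the single bound controls \<open>\<bar>Z\<bar>\<close>.\<close>

lemma coherent_pairing_decay:
  "\<exists>C\<ge>0. \<forall>(A :: 'n::{finite,linorder} operator) X Z.
    (\<forall>\<alpha>. (\<Sum>j\<in>UNIV. \<alpha> j) \<le> N \<longrightarrow> L2_bounded (ad_a_multi \<alpha> A)) \<longrightarrow>
    cmod (L2_inner (L2_extension A (coherent (X + Z))) (coherent (X - Z)))
      \<le> C * (\<Sum>\<alpha> | (\<Sum>j\<in>UNIV. \<alpha> j) \<le> N. operator_norm (ad_a_multi \<alpha> A)) * (1 / (1 + norm Z) ^ N)"
proof -
  let ?n = "real CARD('n)"
  \<comment> \<open>Adding 1 makes \<open>c\<close> positive, as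
    \<open>L2_bounded_pairing_bound\<close> requires.\<close>
  define c where "c = L2_norm (coherent (0 :: ((real, 'n) vec) \<times> ((real, 'n) vec))) + 1"
  \<comment> \<open>Summing over directions and orders gives one bound for every \<open>j\<close>
    and every \<open>m \<le> N\<close>; the origin serves as reference point.\<close>
  define H where "H = (\<Sum>j\<in>UNIV. \<Sum>m\<le>N. L2_norm (hermite_state j m (0 :: ((real, 'n) vec) \<times> ((real, 'n) vec))))"
  have c: "c > 0" and H: "H \<ge> 0"
    by (auto simp: c_def H_def intro!: add_nonneg_pos sum_nonneg L2_norm_nonneg)
  have coherent: "L2_norm (coherent X) \<le> c" for X :: "(real, 'n) vec \<times> (real, 'n) vec"
    by (subst L2_norm_coherent) (simp add: c_def)
  have hermite: "L2_norm (hermite_state j m X) \<le> H" if "m \<le> N" for j :: 'n and m X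
  proof -
    have "L2_norm (hermite_state j m X) \<le> (\<Sum>m\<le>N. L2_norm (hermite_state j m (0 :: ((real, 'n) vec) \<times> ((real, 'n) vec))))"
      unfolding L2_norm_hermite_state[of j m X] using that
      by (intro member_le_sum) (auto intro: L2_norm_nonneg)
    also have "\<dots> \<le> H"
      unfolding H_def by (intro member_le_sum) (auto intro!: sum_nonneg L2_norm_nonneg)
    finally show ?thesis .
  qed
  \<comment> \<open>The first two factors come from comparing \<open>(1 + norm Z) ^ N\<close> with a
    power of one coordinate, the next \<open>2 ^ N\<close> from the iterated recurrence, and
    \<open>c * H\<close> from the norms of the two states.\<close>
  define C where "C = 2 ^ N * (1 + ?n ^ N) * (2 ^ N * (c * H))"
  have "cmod (L2_inner (L2_extension A (coherent (X + Z))) (coherent (X - Z)))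
      \<le> C * (\<Sum>\<alpha> | (\<Sum>j\<in>UNIV. \<alpha> j) \<le> N. operator_norm (ad_a_multi \<alpha> A)) * (1 / (1 + norm Z) ^ N)"
    if A: "\<And>\<alpha>. (\<Sum>j\<in>UNIV. \<alpha> j) \<le> N \<Longrightarrow> L2_bounded (ad_a_multi \<alpha> A)" for A :: "'n operator" and X Z
  proof -
    define S where "S = (\<Sum>\<alpha> | (\<Sum>j\<in>UNIV. \<alpha> j) \<le> N. operator_norm (ad_a_multi \<alpha> A))"
    define G where "G = cmod (L2_inner (L2_extension A (coherent (X + Z))) (coherent (X - Z)))"
    define z where "z j = Complex (fst Z $ j) (snd Z $ j)" for j
    have bdd: "L2_bounded ((ad_a j ^^ k) A)" if "k \<le> N" for j k
      using A[of "\<lambda>i. if i = j then k else 0"] that by (simp add: ad_a_multi_single)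
    have opnorm: "operator_norm ((ad_a j ^^ k) A) \<le> S" if "k \<le> N" for j k
      unfolding S_def ad_a_multi_single[symmetric]
      using that by (intro member_le_sum finite_multi_indices) (auto intro: operator_norm_nonneg A)
    \<comment> \<open>Both extremes are used: \<open>r = 0\<close> bounds \<open>G\<close> itself,
      and \<open>r = N\<close> gives the decay.\<close>
    have power_bound: "(2 * cmod (z j)) ^ r * G \<le> 2 ^ r * (c * H * S)" if "r \<le> N" for j r
    proof -
      define y \<eta> w \<omega> where "y = fst (X + Z)" "\<eta> = snd (X + Z)" "w = fst (X - Z)" "\<omega> = snd (X - Z)"
      note defs = this
      let ?M = "\<lambda>k m. ((ad_a j ^^ k) A) (coherent (y, \<eta>)) (hermite_state j m (w, - \<omega>))"
      let ?\<zeta> = "Complex ((w - y) $ j) ((\<omega> - \<eta>) $ j)"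
      have rec: "?M (Suc k) m = ?M k (Suc m) + ?\<zeta> * ?M k m" if "k < N" for k m
        using ad_a_pairing[OF bdd[of k j]] that by simp
      have "cmod (?M k m) \<le> c * H * S" if "k \<le> N" "m \<le> N" for k m
      proof -
        have "cmod (?M k m) \<le> c * L2_norm (hermite_state j m (w, - \<omega>)) * operator_norm ((ad_a j ^^ k) A)"
          by (intro L2_bounded_pairing_bound bdd that coherent_schwartz hermite_state_schwartz coherent c)
        also have "\<dots> \<le> c * H * S"
          using that c H by (intro mult_mono hermite opnorm) (auto intro: operator_norm_nonneg bdd L2_norm_nonneg)
        finally show ?thesis .
      qed
      from iterated_recurrence_bound[of N ?M ?\<zeta>, OF rec this, of 0 r 0] that
      have "cmod ?\<zeta> ^ r * cmod (?M 0 0) \<le> 2 ^ r * (c * H * S)"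
        by simp
      moreover have "?\<zeta> = - 2 * z j"
        by (simp add: defs z_def complex_eq_iff)
      moreover have "(y, \<eta>) = X + Z"
        by (simp add: defs prod_eq_iff)
      then have "G = cmod (?M 0 0)"
        unfolding G_def using bdd[of 0 j]
        by (simp add: L2_inner_coherent hermite_state_0 defs(3,4))
      ultimately show ?thesis
        by (simp add: norm_mult)
    qed
    \<comment> \<open>Pigeonhole: \<open>norm Z\<close> is at most the sum of |Re z_j| + |Im z_j|
      \<le> 2 |z_j| over n indices, so some term is at least \<open>norm Z\<close> / n.\<close>
    have "\<exists>j. norm Z \<le> ?n * (2 * cmod (z j))"
    proof (rule ccontr)
      assume "\<not> (\<exists>j. norm Z \<le> ?n * (2 * cmod (z j)))"
      then have less: "?n * (2 * cmod (z j)) < norm Z" for j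
        by (simp add: not_le)
      have "norm Z \<le> norm (fst Z) + norm (snd Z)"
        by (metis norm_Pair_le prod.collapse)
      also have "\<dots> \<le> (\<Sum>j\<in>UNIV. \<bar>fst Z $ j\<bar>) + (\<Sum>j\<in>UNIV. \<bar>snd Z $ j\<bar>)"
        by (intro add_mono norm_le_l1_cart)
      also have "\<dots> \<le> (\<Sum>j\<in>UNIV. 2 * cmod (z j))"
        unfolding sum.distrib[symmetric]
      proof (rule sum_mono)
        show "\<bar>fst Z $ j\<bar> + \<bar>snd Z $ j\<bar> \<le> 2 * cmod (z j)" for j
          using abs_Re_le_cmod[of "z j"] abs_Im_le_cmod[of "z j"] by (simp add: z_def)
      qed
      finally have "?n * norm Z \<le> (\<Sum>j\<in>UNIV. ?n * (2 * cmod (z j)))"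
        by (simp add: sum_distrib_left[symmetric] mult_left_mono)
      also have "\<dots> < (\<Sum>j\<in>(UNIV :: 'n set). norm Z)"
        by (rule sum_strict_mono) (use less in auto)
      finally show False
        by simp
    qed
    then obtain j where j: "norm Z \<le> ?n * (2 * cmod (z j))" ..
    have G: "G \<ge> 0"
      by (simp add: G_def)
    have "(1 + norm Z) ^ N \<le> (2 * max 1 (norm Z)) ^ N"
      by (intro power_mono) auto
    \<comment> \<open>The larger of 1 and \<open>norm Z ^ N\<close> is at most their sum.\<close>
    also have "\<dots> \<le> 2 ^ N * (1 + norm Z ^ N)"
      by (auto simp: power_mult_distrib max_def)
    also have "\<dots> \<le> 2 ^ N * (1 + ?n ^ N * (2 * cmod (z j)) ^ N)"
      using power_mono[OF j norm_ge_zero, of N] by (simp add: power_mult_distrib)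
    finally have "(1 + norm Z) ^ N * G \<le> 2 ^ N * (1 + ?n ^ N * (2 * cmod (z j)) ^ N) * G"
      by (rule mult_right_mono) (rule G)
    also have "\<dots> = 2 ^ N * (G + ?n ^ N * ((2 * cmod (z j)) ^ N * G))"
      by (simp add: algebra_simps)
    also have "\<dots> \<le> 2 ^ N * (2 ^ N * (c * H * S) + ?n ^ N * (2 ^ N * (c * H * S)))"
    proof (intro mult_left_mono add_mono)
      have "G \<le> 1 * (c * H * S)"
        using power_bound[of 0 j] by simp
      \<comment> \<open>Enlarging the factor requires \<open>c * H * S\<close> to be nonnegative,
        which follows from 0 \<le> G and the bound just obtained.\<close>
      also have "\<dots> \<le> 2 ^ N * (c * H * S)"
        using \<open>G \<le> 1 * (c * H * S)\<close> G by (intro mult_right_mono) auto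
      finally show "G \<le> 2 ^ N * (c * H * S)" .
      show "(2 * cmod (z j)) ^ N * G \<le> 2 ^ N * (c * H * S)"
        using power_bound[of N j] by simp
    qed auto
    also have "\<dots> = C * S"
      by (simp add: C_def algebra_simps)
    finally have "(1 + norm Z) ^ N * G \<le> C * S" .
    moreover have "0 < (1 + norm Z) ^ N"
      by (intro zero_less_power add_pos_nonneg) auto
    ultimately have "G \<le> C * S / (1 + norm Z) ^ N"
      by (simp only: pos_le_divide_eq mult.commute)
    then show ?thesis
      by (simp add: G_def S_def)
  qed
  moreover have "C \<ge> 0"
    using c H by (simp add: C_def)
  ultimately show ?thesis
    by blast
qed

section \<open>Integration of the decay estimate over phase space\<close>

text \<open>Integrability is asserted along with the inequality because the integral of a
  non-integrable function is 0 by convention.\<close>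

theorem proposition1p5:
  shows "\<exists>C::real. \<forall>(A :: 'n::{finite,linorder} operator) (X :: (real ^ 'n::{finite,linorder}) \<times> (real ^ 'n::{finite,linorder})).
    schwartz_operator A \<longrightarrow>
    (\<forall>\<alpha>. (\<Sum>j\<in>UNIV. \<alpha> j) \<le> 2 * CARD('n) + 1 \<longrightarrow> L2_bounded (ad_a_multi \<alpha> A)) \<longrightarrow>
      integrable lborel
        (\<lambda>Z. cmod (L2_inner (L2_extension A (coherent (X + Z))) (coherent (X - Z)))) \<and>
      (LINT Z|lborel. cmod (L2_inner (L2_extension A (coherent (X + Z))) (coherent (X - Z))))
        \<le> C * (\<Sum>\<alpha> | (\<Sum>j\<in>UNIV. \<alpha> j) \<le> 2 * CARD('n) + 1. operator_norm (ad_a_multi \<alpha> A))"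
proof -
  \<comment> \<open>The order of the commutators is the phase-space dimension 2n plus 1, exactly the
    exponent in \<open>integrable_power_decay\<close>.\<close>
  define N where "N = 2 * CARD('n) + 1"
  have N: "N = DIM(((real, 'n) vec) \<times> ((real, 'n) vec)) + 1"
    by (simp add: N_def)
  obtain C where decay: "\<And>(A :: 'n operator) X Z.
    (\<And>\<alpha>. (\<Sum>j\<in>UNIV. \<alpha> j) \<le> N \<Longrightarrow> L2_bounded (ad_a_multi \<alpha> A)) \<Longrightarrow>
    cmod (L2_inner (L2_extension A (coherent (X + Z))) (coherent (X - Z)))
      \<le> C * (\<Sum>\<alpha> | (\<Sum>j\<in>UNIV. \<alpha> j) \<le> N. operator_norm (ad_a_multi \<alpha> A)) * (1 / (1 + norm Z) ^ N)"
    using coherent_pairing_decay[of N] by blast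
  define I where "I = (LINT Z|(lborel :: (((real, 'n) vec) \<times> ((real, 'n) vec)) measure). 1 / (1 + norm Z) ^ N)"
  have int: "integrable lborel (\<lambda>Z :: ((real, 'n) vec) \<times> ((real, 'n) vec). 1 / (1 + norm Z) ^ N)"
    unfolding N by (rule integrable_power_decay)
  show ?thesis
    unfolding N_def[symmetric]
  proof (intro exI[of _ "C * I"] allI impI)
    fix A :: "'n operator" and X :: "((real, 'n) vec) \<times> ((real, 'n) vec)"
    assume A: "\<forall>\<alpha>. (\<Sum>j\<in>UNIV. \<alpha> j) \<le> N \<longrightarrow> L2_bounded (ad_a_multi \<alpha> A)"
    define S where "S = (\<Sum>\<alpha> | (\<Sum>j\<in>UNIV. \<alpha> j) \<le> N. operator_norm (ad_a_multi \<alpha> A))"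
    let ?G = "\<lambda>Z. cmod (L2_inner (L2_extension A (coherent (X + Z))) (coherent (X - Z)))"
    have bound: "?G Z \<le> C * S * (1 / (1 + norm Z) ^ N)" for Z
      unfolding S_def using A by (intro decay) auto
    \<comment> \<open>The zero multi-index is written as a zero power in one arbitrary direction,
      for which \<open>undefined\<close> is a convenient name; this recovers \<open>A\<close>
      itself.\<close>
    have "ad_a_multi (\<lambda>i. if i = undefined then 0 else 0) A = (ad_a undefined ^^ 0) A"
      by (rule ad_a_multi_single)
    then have "L2_bounded A"
      using A[rule_format, of "\<lambda>_. 0"] by simp
    then have "bounded_L2_operator (L2_extension A)"
      using is_L2_extension_L2_extension by (auto simp: is_L2_extension_def)
    then have "continuous_on UNIV ?G"
      by (intro continuous_on_norm continuous_on_L2_inner_coherent continuous_intros)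
    then have meas: "?G \<in> borel_measurable lborel"
      by (simp add: borel_measurable_continuous_onI)
    have G: "integrable lborel ?G"
      by (rule Bochner_Integration.integrable_bound[OF integrable_mult_right[OF int, of "C * S"] meas])
        (unfold real_norm_def abs_norm_cancel, intro AE_I2 order_trans[OF bound abs_ge_self])
    moreover have "integral\<^sup>L lborel ?G \<le> (LINT Z|lborel. C * S * (1 / (1 + norm (Z :: ((real, 'n) vec) \<times> ((real, 'n) vec))) ^ N))"
      by (rule integral_mono[OF G integrable_mult_right[OF int] bound])
    then have "integral\<^sup>L lborel ?G \<le> C * I * S"
      unfolding integral_mult_right_zero I_def[symmetric] by (simp only: mult_ac)
    ultimately show "integrable lborel ?G \<and> integral\<^sup>L lborel ?G
        \<le> C * I * (\<Sum>\<alpha> | (\<Sum>j\<in>UNIV. \<alpha> j) \<le> N. operator_norm (ad_a_multi \<alpha> A))"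
      by (simp add: S_def)
  qed
qed

end
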